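(* Let $n,m\ge1$ with $n$ odd, and let $\varphi=C_1\wedge\dots\wedge C_n$ be a CNF formula over $x_1,\dots,x_m$ in which no clause contains both $x_j$ and $\neg x_j$. Let $A_\varphi$ be the associated cellular automaton. Then the map $A_\varphi:\mathrm{Config}_{n,m}\to\mathrm{Config}_{n,m}$ is injective if and only if $\varphi$ is not satisfiable.
   Context: $[k]=\{0,\dots,k-1\}$; $\square$ is a symbol meaning "absent". States. A state is a tuple $s=((i,j),\mathrm{flag},a,\mathsf{pd},\mathsf{pc},\mathrm{label})$, with components written $\mathrm{coord}(s)=(i,j)$, $\mathrm{flag}(s)$, $a(s)$, $\mathsf{pd}(s)$, $\mathsf{pc}(s)$, $\mathrm{label}(s)$. The set $S_{n,m}$ consists of exactly the following tuples (in (1)-(6), $\mathrm{label}\in\{0,1\}$ is arbitrary): (1) $((0,0),\square,\square,\square,\square,\mathrm{label})$; (2) $((i,0),\square,\square,\square,\square,\mathrm{label})$, $1\le i\le n$; (3) $((0,j),\square,a,\square,\square,\mathrm{label})$, $1\le j\le m$, $a\in\{0,1\}$; (4) $((0,m+1),\square,\square,\square,\square,\mathrm{label})$; (5) $((i,m+1),\square,\square,\square,\mathsf{pc},\mathrm{label})$, $1\le i\le n$, $\mathsf{pc}\in\{0,1\}$; (6) $((i,j),\mathrm{flag},a,\mathsf{pd},\square,\mathrm{label})$, $1\le i\le n$, $1\le j\le m$, $\mathrm{flag}\in\{-1,0,1\}$, $a,\mathsf{pd}\in\{0,1\}$; (7) the quiescent state $\mathbf q=((\square,\square),\square,\square,\square,\square,\square)$.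 Configurations. $\mathrm{Config}_{n,m}$ is the set of maps $C:\mathbb Z^2\to S_{n,m}$ with $C(p)\ne\mathbf q$ for $p\in[n+1]\times[m+2]$ and $C(p)=\mathbf q$ for all other $p$. The right, left, below, above neighbours of position $p$ are $p+(0,1)$, $p+(0,-1)$, $p+(1,0)$, $p+(-1,0)$. The written coordinates $\mathrm{coord}(C(p))$ may differ from $p$. Local correctness. Let $s_1\neq\mathbf q$ be the state of a cell with $\mathrm{coord}(s_1)=(i,j)$ and $s_2,s_3,s_4,s_5$ the states of its right, left, below, above neighbours. The cell is locally correct ($s_1$ is locally correct with respect to $s_2,\dots,s_5$) if: (A) for each pair $(k,d)$ among $(2,(0,1)),(3,(0,-1)),(4,(1,0)),(5,(-1,0))$: if $(i,j)+d\in[n+1]\times[m+2]$ then $\mathrm{coord}(s_k)=(i,j)+d$; otherwise $s_k=\mathbf q$; (B) if $1\le i\le n$, $1\le j\le m$: $\mathrm{flag}(s_1)=1$ iff $x_j\in C_i$, $\mathrm{flag}(s_1)=-1$ iff $\neg x_j\in C_i$, $\mathrm{flag}(s_1)=0$ iff neither is in $C_i$; (C1) if $1\le j\le m$: $a(s_k)=a(s_1)$ for each $k\in\{4,5\}$ with $s_k\ne\mathbf q$; (C2) if $j=m+1$, $i\ge2$: $\mathsf{pc}(s_1)=\mathsf{pc}(s_5)\wedge\mathsf{pd}(s_3)$; (C3) if $(i,j)=(1,m+1)$: $\mathsf{pc}(s_1)=1$ iff $\mathsf{pd}(s_3)=1$; (D1) if $1\le i\le n$, $2\le j\le m$: $\mathsf{pd}(s_1)=1$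 iff $\mathsf{pd}(s_3)=1$ or ($\mathrm{flag}(s_1)=1$ and $a(s_1)=1$) or ($\mathrm{flag}(s_1)=-1$ and $a(s_1)=0$); (D2) if $1\le i\le n$, $j=1$: $\mathsf{pd}(s_1)=1$ iff ($\mathrm{flag}(s_1)=1$ and $a(s_1)=1$) or ($\mathrm{flag}(s_1)=-1$ and $a(s_1)=0$); (E) components not used by the cell type (1)-(6) belonging to $(i,j)$ are $\square$ (automatic from the definition of $S_{n,m}$). Colours. A cell (with state $s_1$) is blue if it is locally correct and, in case $\mathrm{coord}(s_1)=(n,m+1)$ (an output cell), also $\mathsf{pc}(s_1)=1$. Otherwise it is red. This depends only on $s_1,\dots,s_5$, so one also says $s_1$ is blue/red with respect to $s_2,\dots,s_5$; $s_1=\mathbf q$ counts as red. Successor. For $(i,j)\in[n+1]\times[m+2]$, $\mathrm{suc}(i,j)$ is given by the first applicable case: $(i,j+1)$ if $(i,j)=(0,0)$ or ($i$ even and $1\le j\le m$); $(i,j-1)$ if $(i,j)=(n,1)$ or ($i$ odd and $2\le j\le m+1$); $(i+1,j)$ if ($i$ odd and $j=1$) or ($i$ even and $j=m+1$); $(i-1,j)$ if $i\ge1$ and $j=0$. For a blue cell with written coordinates $(i,j)$, exactly one of its four neighbours has written coordinates $\mathrm{suc}(i,j)$; this neighbour is its successor. Automaton. $A_\varphi=(2,S_{n,m},N,f_\varphi)$ with $N=((0,0),(0,1),(0,-1),(1,0),(-1,0))$, where $f_\varphi(s_1,\dots,s_5)=s_1$ if $s_1$ is red with respect to $s_2,\dots,s_5$,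 and otherwise $f_\varphi(s_1,\dots,s_5)$ is $s_1$ with its label replaced by $\mathrm{label}(s_1)\oplus\mathrm{label}(s_k)$, where $s_k$ is the successor's state and $\oplus$ is addition mod 2. It acts by applying $f_\varphi$ to the states of each cell and its right, left, below, above neighbours, and maps $\mathrm{Config}_{n,m}$ to itself. *)

theory Defs
  imports Complex_Main "HOL-Library.Z2" "HOL-Library.Product_Plus"
begin

section \<open>CNF formulas\<close>

datatype literal = Pos nat | Neg nat

type_synonym clause = "literal set"

type_synonym cnf = "clause list"

text \<open>A formula \<open>C\<^sub>1 \<and> \<dots> \<and> C\<^sub>n\<close> over \<open>x\<^sub>1, \<dots>, x\<^sub>m\<close>; the clause \<open>C\<^sub>i\<close> is the list entry with
  index \<open>i - 1\<close>.  Empty and repeated clauses are allowed.\<close>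

definition cnf_formula :: "nat \<Rightarrow> nat \<Rightarrow> cnf \<Rightarrow> bool" where
  "cnf_formula n m \<phi> \<longleftrightarrow> length \<phi> = n \<and> (\<forall>C\<in>set \<phi>. C \<subseteq> Pos ` {1..m} \<union> Neg ` {1..m})"

definition clause_at :: "cnf \<Rightarrow> int \<Rightarrow> clause" where
  "clause_at \<phi> i = \<phi> ! nat (i - 1)"

fun literal_true :: "(nat \<Rightarrow> bool) \<Rightarrow> literal \<Rightarrow> bool" where
  "literal_true v (Pos j) \<longleftrightarrow> v j"
| "literal_true v (Neg j) \<longleftrightarrow> \<not> v j"

definition satisfiable :: "cnf \<Rightarrow> bool" where
  "satisfiable \<phi> \<longleftrightarrow> (\<exists>v. \<forall>C\<in>set \<phi>. \<exists>l\<in>C. literal_true v l)"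


section \<open>Two-dimensional cellular automata\<close>

text \<open>The dimension 2 is fixed by the type of cell positions.  The local rule receives the
  states of the neighbouring cells in the order in which the neighbourhood lists them.\<close>

record 's automaton =
  ca_states :: "'s set"
  ca_neighbourhood :: "(int \<times> int) list"
  ca_rule :: "'s list \<Rightarrow> 's"

definition ca_map :: "'s automaton \<Rightarrow> (int \<times> int \<Rightarrow> 's) \<Rightarrow> (int \<times> int \<Rightarrow> 's)" where
  "ca_map A C = (\<lambda>p. ca_rule A (map (\<lambda>d. C (p + d)) (ca_neighbourhood A)))"


section \<open>States and configurations\<close>

text \<open>The symbol for ``absent'' is \<^const>\<open>None\<close>.  The type \<^typ>\<open>bit\<close> is the field with two
  elements, so its addition is addition modulo 2.  The component \<open>aval\<close> is the assignment
  bit \<open>a\<close>.\<close>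

datatype state = State
  (coord: "int option \<times> int option")
  (flag: "int option")
  (aval: "bit option")
  (pd: "bit option")
  (pc: "bit option")
  (label: "bit option")

abbreviation pos :: "int \<times> int \<Rightarrow> int option \<times> int option" where
  "pos p \<equiv> (Some (fst p), Some (snd p))"

definition quiescent :: state where
  "quiescent = State (None, None) None None None None None"

definition states :: "nat \<Rightarrow> nat \<Rightarrow> state set" where
  "states n m =
     {State (pos (0, 0)) None None None None (Some l) | l. True} \<union>
     {State (pos (i, 0)) None None None None (Some l) | i l. 1 \<le> i \<and> i \<le> int n} \<union>
     {State (pos (0, j)) None (Some a) None None (Some l) | j a l. 1 \<le> j \<and> j \<le> int m} \<union>
     {State (pos (0, int m + 1)) None None None None (Some l) | l. True} \<union>
     {State (pos (i, int m + 1)) None None None (Some c) (Some l) | i c l. 1 \<le> i \<and> i \<le> int n} \<union>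
     {State (pos (i, j)) (Some f) (Some a) (Some d) None (Some l) | i j f a d l.
        1 \<le> i \<and> i \<le> int n \<and> 1 \<le> j \<and> j \<le> int m \<and> f \<in> {-1, 0, 1}} \<union>
     {quiescent}"

text \<open>The grid \<open>[n+1] \<times> [m+2]\<close>, where \<open>[k] = {0, \<dots>, k - 1}\<close>; the first coordinate is the
  row, counted downwards.\<close>

definition grid :: "nat \<Rightarrow> nat \<Rightarrow> (int \<times> int) set" where
  "grid n m = {0..int n} \<times> {0..int m + 1}"

definition Config :: "nat \<Rightarrow> nat \<Rightarrow> (int \<times> int \<Rightarrow> state) set" where
  "Config n m = {C. (\<forall>p. C p \<in> states n m) \<and>
     (\<forall>p\<in>grid n m. C p \<noteq> quiescent) \<and> (\<forall>p. p \<notin> grid n m \<longrightarrow> C p = quiescent)}"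


section \<open>Local correctness and colours\<close>

text \<open>Throughout, \<open>s\<^sub>2\<close>, \<open>s\<^sub>3\<close>, \<open>s\<^sub>4\<close>, \<open>s\<^sub>5\<close> are the states of the right, left, below and above
  neighbours of a cell in state \<open>s\<^sub>1\<close>.\<close>

definition coords_correct ::
    "nat \<Rightarrow> nat \<Rightarrow> int \<times> int \<Rightarrow> state \<Rightarrow> state \<Rightarrow> state \<Rightarrow> state \<Rightarrow> bool" where
  "coords_correct n m p s2 s3 s4 s5 \<longleftrightarrow>
     (\<forall>(s, d) \<in> {(s2, (0, 1)), (s3, (0, -1)), (s4, (1, 0)), (s5, (-1, 0))}.
        if p + d \<in> grid n m then coord s = pos (p + d) else s = quiescent)"

text \<open>The literal of \<open>x\<^sub>j\<close> recorded in the flag is made true by the assignment bit.\<close>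

definition flag_true :: "state \<Rightarrow> bool" where
  "flag_true s \<longleftrightarrow>
     (flag s = Some 1 \<and> aval s = Some 1) \<or> (flag s = Some (-1) \<and> aval s = Some 0)"

text \<open>That components not used by the type of the cell are absent holds for every element of
  \<^const>\<open>states\<close> and is not repeated here.  By \<^const>\<open>coords_correct\<close>, the components of
  neighbours used in the conditions on \<^const>\<open>pc\<close> and \<^const>\<open>pd\<close> are present.  The quiescent
  state is not locally correct, hence never blue.\<close>

definition locally_correct ::
    "nat \<Rightarrow> nat \<Rightarrow> cnf \<Rightarrow> state \<Rightarrow> state \<Rightarrow> state \<Rightarrow> state \<Rightarrow> state \<Rightarrow> bool" where
  "locally_correct n m \<phi> s1 s2 s3 s4 s5 \<longleftrightarrow> s1 \<noteq> quiescent \<and>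
     (\<exists>i j. coord s1 = pos (i, j) \<and>
       coords_correct n m (i, j) s2 s3 s4 s5 \<and>
       (1 \<le> i \<and> i \<le> int n \<and> 1 \<le> j \<and> j \<le> int m \<longrightarrow>
          (flag s1 = Some 1 \<longleftrightarrow> Pos (nat j) \<in> clause_at \<phi> i) \<and>
          (flag s1 = Some (-1) \<longleftrightarrow> Neg (nat j) \<in> clause_at \<phi> i) \<and>
          (flag s1 = Some 0 \<longleftrightarrow>
             Pos (nat j) \<notin> clause_at \<phi> i \<and> Neg (nat j) \<notin> clause_at \<phi> i)) \<and>
       (1 \<le> j \<and> j \<le> int m \<longrightarrow> (\<forall>s\<in>{s4, s5}. s \<noteq> quiescent \<longrightarrow> aval s = aval s1)) \<and>
       (j = int m + 1 \<and> 2 \<le> i \<longrightarrow>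
          (pc s1 = Some 1 \<longleftrightarrow> pc s5 = Some 1 \<and> pd s3 = Some 1)) \<and>
       ((i, j) = (1, int m + 1) \<longrightarrow> (pc s1 = Some 1 \<longleftrightarrow> pd s3 = Some 1)) \<and>
       (1 \<le> i \<and> i \<le> int n \<and> 2 \<le> j \<and> j \<le> int m \<longrightarrow>
          (pd s1 = Some 1 \<longleftrightarrow> pd s3 = Some 1 \<or> flag_true s1)) \<and>
       (1 \<le> i \<and> i \<le> int n \<and> j = 1 \<longrightarrow> (pd s1 = Some 1 \<longleftrightarrow> flag_true s1)))"

definition blue ::
    "nat \<Rightarrow> nat \<Rightarrow> cnf \<Rightarrow> state \<Rightarrow> state \<Rightarrow> state \<Rightarrow> state \<Rightarrow> state \<Rightarrow> bool" where
  "blue n m \<phi> s1 s2 s3 s4 s5 \<longleftrightarrow> locally_correct n m \<phi> s1 s2 s3 s4 s5 \<and>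
     (coord s1 = pos (int n, int m + 1) \<longrightarrow> pc s1 = Some 1)"


section \<open>The automaton of a formula\<close>

text \<open>For odd \<open>n\<close> the cases below exhaust the grid.\<close>

definition suc :: "nat \<Rightarrow> nat \<Rightarrow> int \<times> int \<Rightarrow> int \<times> int" where
  "suc n m = (\<lambda>(i, j).
     if (i, j) = (0, 0) \<or> (even i \<and> 1 \<le> j \<and> j \<le> int m) then (i, j + 1)
     else if (i, j) = (int n, 1) \<or> (odd i \<and> 2 \<le> j \<and> j \<le> int m + 1) then (i, j - 1)
     else if (odd i \<and> j = 1) \<or> (even i \<and> j = int m + 1) then (i + 1, j)
     else if 1 \<le> i \<and> j = 0 then (i - 1, j)
     else undefined)"

definition successor_state ::
    "nat \<Rightarrow> nat \<Rightarrow> state \<Rightarrow> state \<Rightarrow> state \<Rightarrow> state \<Rightarrow> state \<Rightarrow> state" where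
  "successor_state n m s1 s2 s3 s4 s5 =
     (THE s. s \<in> {s2, s3, s4, s5} \<and>
        coord s = pos (suc n m (the (fst (coord s1)), the (snd (coord s1)))))"

fun set_label :: "bit \<Rightarrow> state \<Rightarrow> state" where
  "set_label l (State p f a d c l') = State p f a d c (Some l)"

definition local_rule ::
    "nat \<Rightarrow> nat \<Rightarrow> cnf \<Rightarrow> state \<Rightarrow> state \<Rightarrow> state \<Rightarrow> state \<Rightarrow> state \<Rightarrow> state" where
  "local_rule n m \<phi> s1 s2 s3 s4 s5 =
     (if blue n m \<phi> s1 s2 s3 s4 s5
      then set_label (the (label s1) + the (label (successor_state n m s1 s2 s3 s4 s5))) s1
      else s1)"

definition formula_automaton :: "nat \<Rightarrow> nat \<Rightarrow> cnf \<Rightarrow> state automaton" where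
  "formula_automaton n m \<phi> =
     \<lparr> ca_states = states n m,
       ca_neighbourhood = [(0, 0), (0, 1), (0, -1), (1, 0), (-1, 0)],
       ca_rule = (\<lambda>ss. local_rule n m \<phi> (ss ! 0) (ss ! 1) (ss ! 2) (ss ! 3) (ss ! 4)) \<rparr>"


section \<open>Well-definedness\<close>

lemma set_label_in_states:
  "s \<in> states n m \<Longrightarrow> s \<noteq> quiescent \<Longrightarrow> set_label l s \<in> states n m \<and> set_label l s \<noteq> quiescent"
  unfolding states_def by (auto simp: quiescent_def)

text \<open>The automaton maps \<^const>\<open>Config\<close> to itself.\<close>

lemma ca_map_in_Config:
  assumes "C \<in> Config n m"
  shows "ca_map (formula_automaton n m \<phi>) C \<in> Config n m"
proof -
  have red: "\<not> blue n m \<phi> quiescent s2 s3 s4 s5" for s2 s3 s4 s5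
    by (simp add: blue_def locally_correct_def)
  have "local_rule n m \<phi> s s2 s3 s4 s5 \<in> states n m \<and>
      (local_rule n m \<phi> s s2 s3 s4 s5 = quiescent \<longleftrightarrow> s = quiescent)"
    if "s \<in> states n m" for s s2 s3 s4 s5
  proof (cases "blue n m \<phi> s s2 s3 s4 s5")
    case True
    then have "s \<noteq> quiescent" using red by auto
    then show ?thesis
      using set_label_in_states[OF that] True unfolding local_rule_def by (metis (full_types))
  qed (simp add: local_rule_def that)
  then have rule: "local_rule n m \<phi> (C p) s2 s3 s4 s5 \<in> states n m \<and>
      (local_rule n m \<phi> (C p) s2 s3 s4 s5 = quiescent \<longleftrightarrow> C p = quiescent)" for p s2 s3 s4 s5
    using assms unfolding Config_def by blast
  have "ca_map (formula_automaton n m \<phi>) C p = local_rule n m \<phi> (C p)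
      (C (p + (0, 1))) (C (p + (0, -1))) (C (p + (1, 0))) (C (p + (-1, 0)))" for p
    unfolding ca_map_def formula_automaton_def by (cases p) simp
  with rule show ?thesis
    using assms unfolding Config_def mem_Collect_eq by metis
qed

text \<open>The definite description in \<^const>\<open>successor_state\<close> is meaningful for blue cells.\<close>

lemma ex1_successor:
  assumes "odd n" and "m \<ge> 1" and "s1 \<in> states n m"
    and "locally_correct n m \<phi> s1 s2 s3 s4 s5"
  shows "\<exists>!k. k \<in> {0..<4} \<and> coord ([s2, s3, s4, s5] ! k) =
           pos (suc n m (the (fst (coord s1)), the (snd (coord s1))))"
proof -
  from assms(4) obtain i j where ij: "coord s1 = pos (i, j)"
    and A: "coords_correct n m (i, j) s2 s3 s4 s5" and nq: "s1 \<noteq> quiescent"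
    unfolding locally_correct_def by (elim conjE exE) (rule that)
  have g: "(i, j) \<in> grid n m"
    using assms(3) ij nq assms(1) unfolding states_def grid_def by auto
  have R: "coord s = pos (suc n m (i, j)) \<longleftrightarrow> suc n m (i, j) = (i, j) + d"
    if "suc n m (i, j) \<in> grid n m"
      and "if (i, j) + d \<in> grid n m then coord s = pos ((i, j) + d) else s = quiescent" for s d
  proof (cases "(i, j) + d \<in> grid n m")
    case True
    then show ?thesis using that by (auto simp: prod_eq_iff)
  next
    case False
    then have "suc n m (i, j) \<noteq> (i, j) + d" and "coord s = (None, None)"
      using that by (auto simp: quiescent_def)
    then show ?thesis by simp
  qed
  have A': "if (i, j) + (0, 1) \<in> grid n m then coord s2 = pos ((i, j) + (0, 1)) else s2 = quiescent"
    "if (i, j) + (0, -1) \<in> grid n m then coord s3 = pos ((i, j) + (0, -1)) else s3 = quiescent"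
    "if (i, j) + (1, 0) \<in> grid n m then coord s4 = pos ((i, j) + (1, 0)) else s4 = quiescent"
    "if (i, j) + (-1, 0) \<in> grid n m then coord s5 = pos ((i, j) + (-1, 0)) else s5 = quiescent"
    using A unfolding coords_correct_def by simp_all
  have S: "suc n m (i, j) \<in> grid n m \<and>
      suc n m (i, j) \<in> {(i, j + 1), (i, j - 1), (i + 1, j), (i - 1, j)}"
  proof -
    have bounds: "0 \<le> i" "i \<le> int n" "0 \<le> j" "j \<le> int m + 1"
      using g by (auto simp: grid_def)
    have last_row: "i < int n" if "even i"
      using that bounds(2) assms(1) by (cases "i = int n") auto
    consider (right) "(i, j) = (0, 0) \<or> (even i \<and> 1 \<le> j \<and> j \<le> int m)"
      | (left) "\<not> ((i, j) = (0, 0) \<or> (even i \<and> 1 \<le> j \<and> j \<le> int m))"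
          "(i, j) = (int n, 1) \<or> (odd i \<and> 2 \<le> j \<and> j \<le> int m + 1)"
      | (down) "\<not> ((i, j) = (0, 0) \<or> (even i \<and> 1 \<le> j \<and> j \<le> int m))"
          "\<not> ((i, j) = (int n, 1) \<or> (odd i \<and> 2 \<le> j \<and> j \<le> int m + 1))"
          "(odd i \<and> j = 1) \<or> (even i \<and> j = int m + 1)"
      | (up) "\<not> ((i, j) = (0, 0) \<or> (even i \<and> 1 \<le> j \<and> j \<le> int m))"
          "\<not> ((i, j) = (int n, 1) \<or> (odd i \<and> 2 \<le> j \<and> j \<le> int m + 1))"
          "\<not> ((odd i \<and> j = 1) \<or> (even i \<and> j = int m + 1))"
      by blast
    then show ?thesis
    proof cases
      case right
      then have "suc n m (i, j) = (i, j + 1)" by (simp add: suc_def)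
      then show ?thesis using right bounds by (auto simp: grid_def)
    next
      case left
      then have "suc n m (i, j) = (i, j - 1)" by (simp only: suc_def prod.case if_False if_True)
      then show ?thesis using left bounds by (auto simp: grid_def)
    next
      case down
      then have "suc n m (i, j) = (i + 1, j)" by (simp only: suc_def prod.case if_False if_True)
      moreover have "i < int n"
        using down(2,3) last_row bounds(2) by (cases "i = int n") auto
      ultimately show ?thesis using bounds by (auto simp: grid_def)
    next
      case up
      have "\<not> 1 \<le> j"
      proof
        assume j: "1 \<le> j"
        show False
        proof (cases "even i")
          case True
          with up(1) j have "\<not> j \<le> int m" by blast
          with bounds have "j = int m + 1" by linarith
          with True up(3) show False by blast
        next
          case False
          with up(2) bounds have "\<not> 2 \<le> j" by blast
          with j have "j = 1" by linarith
          with False up(3) show False by blast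
        qed
      qed
      with bounds have j: "j = 0" by linarith
      with up(1) have "i \<noteq> 0" by blast
      with bounds have i: "1 \<le> i" by linarith
      have "suc n m (i, j) = (i - 1, j)"
        using i j by (simp add: suc_def)
      then show ?thesis using i bounds by (auto simp: grid_def)
    qed
  qed
  have four: "{0..<4} = {0, 1, 2, 3::nat}" by auto
  have N: "coord s2 = pos (suc n m (i, j)) \<longleftrightarrow> suc n m (i, j) = (i, j + 1)"
    "coord s3 = pos (suc n m (i, j)) \<longleftrightarrow> suc n m (i, j) = (i, j - 1)"
    "coord s4 = pos (suc n m (i, j)) \<longleftrightarrow> suc n m (i, j) = (i + 1, j)"
    "coord s5 = pos (suc n m (i, j)) \<longleftrightarrow> suc n m (i, j) = (i - 1, j)"
    using R[OF conjunct1[OF S] A'(1)] R[OF conjunct1[OF S] A'(2)]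
      R[OF conjunct1[OF S] A'(3)] R[OF conjunct1[OF S] A'(4)] by simp_all
  have ij': "(the (fst (coord s1)), the (snd (coord s1))) = (i, j)"
    by (simp add: ij)
  from S consider "suc n m (i, j) = (i, j + 1)" | "suc n m (i, j) = (i, j - 1)"
    | "suc n m (i, j) = (i + 1, j)" | "suc n m (i, j) = (i - 1, j)"
    by blast
  then show ?thesis
  proof cases
    case 1
    show ?thesis unfolding ij' four by (rule ex1I[of _ 0]) (use N 1 in \<open>auto\<close>)
  next
    case 2
    show ?thesis unfolding ij' four by (rule ex1I[of _ 1]) (use N 2 in \<open>auto\<close>)
  next
    case 3
    show ?thesis unfolding ij' four by (rule ex1I[of _ 2]) (use N 3 in \<open>auto\<close>)
  next
    case 4
    show ?thesis unfolding ij' four by (rule ex1I[of _ 3]) (use N 4 in \<open>auto\<close>)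
  qed
qed

end

theory Submission
  imports Defs
begin

text \<open>The map \<^const>\<open>suc\<close> is a Hamiltonian cycle of the grid.  If two configurations have the same
  image, they differ only in labels, and hence have the same blue cells.  They agree on red cells,
  and on blue cells a label difference is passed on to the successor.  So a single difference
  spreads along the whole cycle, whose cells are all blue and therefore carry a correct evaluation
  of the formula under some assignment, with output \<open>1\<close>.  Conversely, a satisfying assignment
  yields a configuration all of whose cells are blue; with constant label \<open>0\<close> and with constant
  label \<open>1\<close> it has the same image, because \<open>1 + 1 = 0\<close>.\<close>

section \<open>The successor cycle\<close>

text \<open>The arcs of the cycle: after \<open>(0, 0)\<close>, even rows run right and odd rows run
  left within columns 1 to \<open>m + 1\<close>, with descents in between. As \<open>n\<close> is
  odd, the bottom row ends at \<open>(n, 1)\<close>, from where column 0 leads back up.\<close>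

lemma suc_simps:
  "suc n m (0, 0) = (0, 1)"
  "\<lbrakk>even i; 1 \<le> j; j \<le> int m\<rbrakk> \<Longrightarrow> suc n m (i, j) = (i, j + 1)"
  "\<lbrakk>odd i; 2 \<le> j; j \<le> int m + 1\<rbrakk> \<Longrightarrow> suc n m (i, j) = (i, j - 1)"
  "odd n \<Longrightarrow> suc n m (int n, 1) = (int n, 0)"
  "\<lbrakk>odd i; i \<noteq> int n\<rbrakk> \<Longrightarrow> suc n m (i, 1) = (i + 1, 1)"
  "\<lbrakk>even i; odd n\<rbrakk> \<Longrightarrow> suc n m (i, int m + 1) = (i + 1, int m + 1)"
  "1 \<le> i \<Longrightarrow> suc n m (i, 0) = (i - 1, 0)"
  by (simp_all add: suc_def, auto)

text \<open>The form in which the single cycle is used. The proof follows the cycle from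
  \<open>x\<close> to the origin, and then once around from there.\<close>

lemma suc_closed_imp_grid:
  assumes "odd n" and "x \<in> grid n m" and "P x"
    and closed: "\<And>x. x \<in> grid n m \<Longrightarrow> P x \<Longrightarrow> P (suc n m x)"
    and "y \<in> grid n m"
  shows "P y"
proof -
  \<comment> \<open>First the straight stretches of the cycle (\<open>right\<close>,
    \<open>left\<close>, \<open>up\<close>), then the turns between them.\<close>
  have right: "P (i, k)"
    if "P (i, j)" "even i" "0 \<le> i" "i \<le> int n" "1 \<le> j" "j \<le> k" "k \<le> int m + 1" for i j k
  proof -
    from \<open>j \<le> k\<close> have "k \<le> int m + 1 \<longrightarrow> P (i, k)"
    proof (induction k rule: int_ge_induct)
      case (step k)
      then show ?case
        using closed[of "(i, k)"] suc_simps(2)[of i k m n] that by (auto simp: grid_def)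
    qed (use that in simp)
    then show ?thesis using that by simp
  qed
  have left: "P (i, k)"
    if "P (i, j)" "odd i" "0 \<le> i" "i \<le> int n" "1 \<le> k" "k \<le> j" "j \<le> int m + 1" for i j k
  proof -
    from \<open>k \<le> j\<close> have "1 \<le> k \<longrightarrow> P (i, k)"
    proof (induction k rule: int_le_induct)
      case (step k)
      then show ?case
        using closed[of "(i, k)"] suc_simps(3)[of i k m n] that by (auto simp: grid_def)
    qed (use that in simp)
    then show ?thesis using that by simp
  qed
  have up: "P (i, 0)" if "P (k, 0)" "0 \<le> i" "i \<le> k" "k \<le> int n" for i k
  proof -
    from \<open>i \<le> k\<close> have "0 \<le> i \<longrightarrow> P (i, 0)"
    proof (induction i rule: int_le_induct)
      case (step i)
      then show ?case
        using closed[of "(i, 0)"] suc_simps(7)[of i n m] that by (auto simp: grid_def)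
    qed (use that in simp)
    then show ?thesis using that by simp
  qed
  have bottom: "P (int n, 1) \<Longrightarrow> P (int n, 0)"
    using closed[of "(int n, 1)"] suc_simps(4)[OF \<open>odd n\<close>, of m] by (auto simp: grid_def)
  have down_odd: "P (i + 1, 1)" if "P (i, 1)" "odd i" "0 \<le> i" "i < int n" for i
    using closed[of "(i, 1)"] suc_simps(5)[of i n m] that by (auto simp: grid_def)
  have down_even: "P (i + 1, int m + 1)" if "P (i, int m + 1)" "even i" "0 \<le> i" "i < int n" for i
    using closed[of "(i, int m + 1)"] suc_simps(6)[of i n m] that \<open>odd n\<close> by (auto simp: grid_def)
  \<comment> \<open>Induction on the number of rows below \<open>i\<close>, with the column
    arbitrary: the next row is entered at column 1 or \<open>m + 1\<close>.\<close>
  have to_origin: "P (0, 0)" if "P (i, j)" "0 \<le> i" "i \<le> int n" "1 \<le> j" "j \<le> int m + 1" for i j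
    using that
  proof (induction "nat (int n - i)" arbitrary: i j rule: less_induct)
    case less
    show ?case
    proof (cases "even i")
      case True
      \<comment> \<open>\<open>n\<close> is odd, so an even row is never the last one.\<close>
      with less.prems \<open>odd n\<close> have "i < int n"
        by (cases "i = int n") auto
      with less.prems True have "P (i + 1, int m + 1)"
        using right[of i j "int m + 1"] down_even[of i] by simp
      then show ?thesis
        using less.hyps[of "i + 1" "int m + 1"] less.prems \<open>i < int n\<close> by simp
    next
      case False
      with less.prems have first: "P (i, 1)"
        using left[of i j 1] by simp
      show ?thesis
      proof (cases "i = int n")
        case True
        with first bottom up[of "int n" 0] show ?thesis by simp
      next
        case False
        with \<open>odd i\<close> less.prems first have "P (i + 1, 1)"
          using down_odd[of i] by simp
        then show ?thesis
          using less.hyps[of "i + 1" 1] less.prems False by simp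
      qed
    qed
  qed
  have origin: "P (0, 0)"
  proof (cases "snd x = 0")
    case True
    then show ?thesis
      using up[of "fst x" 0] assms(2,3) by (cases x) (auto simp: grid_def)
  next
    case False
    then show ?thesis
      using to_origin[of "fst x" "snd x"] assms(2,3) by (cases x) (auto simp: grid_def)
  qed
  \<comment> \<open>From the origin, rows are filled from top to bottom: an odd row is entered at
    column \<open>m + 1\<close>, an even one at column 1.\<close>
  have row: "\<forall>j. 1 \<le> j \<and> j \<le> int m + 1 \<longrightarrow> P (i, j)" if "0 \<le> i" "i \<le> int n" for i
  proof -
    from \<open>0 \<le> i\<close> have "i \<le> int n \<longrightarrow> (\<forall>j. 1 \<le> j \<and> j \<le> int m + 1 \<longrightarrow> P (i, j))"
    proof (induction i rule: int_ge_induct)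
      case base
      have "P (0, 1)"
        using closed[of "(0, 0)"] origin suc_simps(1)[of n m] by (auto simp: grid_def)
      then show ?case using right[of 0 1] by simp
    next
      case (step i)
      show ?case
      proof (intro impI allI)
        fix j
        assume i: "i + 1 \<le> int n" and j: "1 \<le> j \<and> j \<le> int m + 1"
        with step have row_i: "P (i, int m + 1)" "P (i, 1)" by simp_all
        show "P (i + 1, j)"
        proof (cases "even i")
          case True
          with row_i down_even[of i] step i have "P (i + 1, int m + 1)" by simp
          then show ?thesis using left[of "i + 1" "int m + 1" j] True step i j by simp
        next
          case False
          with row_i down_odd[of i] step i have "P (i + 1, 1)" by simp
          then show ?thesis using right[of "i + 1" 1 j] False step i j by simp
        qed
      qed
    qed
    then show ?thesis using that by simp
  qed
  \<comment> \<open>Only column 0 remains; it is traversed upwards from the bottom.\<close>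
  have "P (int n, 0)" using bottom row[of "int n"] by simp
  then show ?thesis
    using row up[of "int n"] \<open>y \<in> grid n m\<close>
    by (cases y; cases "snd y = 0") (auto simp: grid_def)
qed


section \<open>The global map\<close>

definition blue_at :: "nat \<Rightarrow> nat \<Rightarrow> cnf \<Rightarrow> (int \<times> int \<Rightarrow> state) \<Rightarrow> int \<times> int \<Rightarrow> bool" where
  "blue_at n m \<phi> C p \<longleftrightarrow>
     blue n m \<phi> (C p) (C (p + (0, 1))) (C (p + (0, -1))) (C (p + (1, 0))) (C (p + (-1, 0)))"

definition successor_at :: "nat \<Rightarrow> nat \<Rightarrow> (int \<times> int \<Rightarrow> state) \<Rightarrow> int \<times> int \<Rightarrow> state" where
  "successor_at n m C p = successor_state n m
     (C p) (C (p + (0, 1))) (C (p + (0, -1))) (C (p + (1, 0))) (C (p + (-1, 0)))"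

lemma ca_map_formula_automaton:
  "ca_map (formula_automaton n m \<phi>) C p =
     (if blue_at n m \<phi> C p
      then set_label (the (label (C p)) + the (label (successor_at n m C p))) (C p) else C p)"
  by (cases p) (simp add: ca_map_def formula_automaton_def local_rule_def blue_at_def successor_at_def)

lemma label_set_label [simp]: "label (set_label l s) = Some l"
  by (cases s) simp

lemma blue_at_coord:
  assumes "blue_at n m \<phi> C p" and "C p \<in> states n m"
  obtains x where "coord (C p) = pos x" and "x \<in> grid n m"
proof -
  obtain i j where ij: "coord (C p) = pos (i, j)"
    using assms(1) unfolding blue_at_def blue_def locally_correct_def by blast
  with assms(2) have "(i, j) \<in> grid n m"
    by (auto simp: states_def grid_def quiescent_def)
  with ij that show thesis by blast
qed

lemma coords_correct_iff:
  "coords_correct n m x s2 s3 s4 s5 \<longleftrightarrow>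
     (if x + (0, 1) \<in> grid n m then coord s2 = pos (x + (0, 1)) else s2 = quiescent) \<and>
     (if x + (0, -1) \<in> grid n m then coord s3 = pos (x + (0, -1)) else s3 = quiescent) \<and>
     (if x + (1, 0) \<in> grid n m then coord s4 = pos (x + (1, 0)) else s4 = quiescent) \<and>
     (if x + (-1, 0) \<in> grid n m then coord s5 = pos (x + (-1, 0)) else s5 = quiescent)"
  by (simp add: coords_correct_def)

text \<open>The successor is specified by written coordinates; here it is located by position. By
  local correctness the neighbour in direction \<open>d\<close> has written coordinates
  \<open>x + d\<close>, so the successor lies in direction \<open>suc n m x - x\<close>, even if
  \<open>x\<close> differs from \<open>p\<close>.\<close>

lemma successor_at_blue:
  assumes "odd n" and "m \<ge> 1" and "C p \<in> states n m" and "blue_at n m \<phi> C p"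
    and "coord (C p) = pos x"
  shows "coord (C (p + (suc n m x - x))) = pos (suc n m x)"
    and "successor_at n m C p = C (p + (suc n m x - x))"
proof -
  define D :: "(int \<times> int) list" where "D = [(0, 1), (0, -1), (1, 0), (-1, 0)]"
  define L where "L = map (\<lambda>d. C (p + d)) D"
  have lc: "locally_correct n m \<phi>
      (C p) (C (p + (0, 1))) (C (p + (0, -1))) (C (p + (1, 0))) (C (p + (-1, 0)))"
    using assms(4) by (simp add: blue_at_def blue_def)
  have x: "(the (fst (coord (C p))), the (snd (coord (C p)))) = x"
    by (simp add: assms(5))
  have four: "{0..<4} = {0, 1, 2, 3::nat}" by auto
  have L4: "L = [C (p + (0, 1)), C (p + (0, -1)), C (p + (1, 0)), C (p + (-1, 0))]"
    by (simp add: L_def D_def)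
  have "\<exists>!k. k \<in> {0..<4} \<and> coord (L ! k) = pos (suc n m x)"
    using ex1_successor[OF assms(1,2,3) lc] unfolding x L4 .
  then obtain k where k: "k < 4" "coord (L ! k) = pos (suc n m x)"
    and uniq: "\<And>k'. k' < 4 \<Longrightarrow> coord (L ! k') = pos (suc n m x) \<Longrightarrow> k' = k"
    by (metis atLeastLessThan_iff zero_le)
  have set_L: "set L = {C (p + (0, 1)), C (p + (0, -1)), C (p + (1, 0)), C (p + (-1, 0))}"
    and len: "length L = 4"
    by (simp_all add: L4)
  \<comment> \<open>The description ranges over states, the known uniqueness over indices; the
    latter implies uniqueness of the state.\<close>
  have "(THE s. s \<in> set L \<and> coord s = pos (suc n m x)) = L ! k"
  proof (rule the_equality)
    show "L ! k \<in> set L \<and> coord (L ! k) = pos (suc n m x)"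
      using k len by simp
    show "s = L ! k" if "s \<in> set L \<and> coord s = pos (suc n m x)" for s
      using that uniq len by (metis in_set_conv_nth)
  qed
  then have succ: "successor_at n m C p = L ! k"
    unfolding successor_at_def successor_state_def x set_L .
  have "coords_correct n m x
      (C (p + (0, 1))) (C (p + (0, -1))) (C (p + (1, 0))) (C (p + (-1, 0)))"
    using lc assms(5) unfolding locally_correct_def by (metis fst_conv option.inject prod.collapse snd_conv)
  \<comment> \<open>Direction \<open>k\<close> cannot lead out of the written grid, since a
    quiescent neighbour has no coordinates.\<close>
  moreover have "\<not> coord quiescent = pos y" for y
    by (simp add: quiescent_def)
  moreover have "k \<in> {0, 1, 2, 3}"
    using k(1) four by (metis atLeastLessThan_iff zero_le)
  ultimately have "pos (suc n m x) = pos (x + D ! k)"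
    using k(2) unfolding coords_correct_iff L4 D_def by (auto split: if_splits)
  then have "suc n m x = x + D ! k"
    by (simp add: prod_eq_iff)
  moreover have "L ! k = C (p + D ! k)"
    unfolding L_def by (rule nth_map) (use k(1) in \<open>simp add: D_def\<close>)
  ultimately show "coord (C (p + (suc n m x - x))) = pos (suc n m x)"
    and "successor_at n m C p = C (p + (suc n m x - x))"
    using k(2) succ by simp_all
qed


section \<open>Configurations with the same image\<close>

text \<open>\<open>set_label\<close> writes even into an absent label, so the first conjunct alone
  would identify \<open>quiescent\<close> with a labelled copy of it.\<close>

definition same_up_to_label :: "state \<Rightarrow> state \<Rightarrow> bool" where
  "same_up_to_label s s' \<longleftrightarrow> set_label 0 s = set_label 0 s' \<and> (s = quiescent \<longleftrightarrow> s' = quiescent)"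

lemma same_up_to_labelD:
  assumes "same_up_to_label s s'"
  shows "coord s = coord s'" "flag s = flag s'" "aval s = aval s'" "pd s = pd s'" "pc s = pc s'"
    "s = quiescent \<longleftrightarrow> s' = quiescent"
  using assms by (cases s; cases s'; simp add: same_up_to_label_def)+

lemma same_up_to_label_label_eqD:
  "same_up_to_label s s' \<Longrightarrow> label s = label s' \<Longrightarrow> s = s'"
  by (cases s; cases s') (simp add: same_up_to_label_def)

text \<open>No condition for blueness inspects a label.\<close>

lemma blue_same_up_to_label:
  assumes "same_up_to_label s1 t1" "same_up_to_label s2 t2" "same_up_to_label s3 t3"
    "same_up_to_label s4 t4" "same_up_to_label s5 t5"
  shows "blue n m \<phi> s1 s2 s3 s4 s5 \<longleftrightarrow> blue n m \<phi> t1 t2 t3 t4 t5"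
  using assms[THEN same_up_to_labelD(1)] assms[THEN same_up_to_labelD(2)]
    assms[THEN same_up_to_labelD(3)] assms[THEN same_up_to_labelD(4)]
    assms[THEN same_up_to_labelD(5)] assms[THEN same_up_to_labelD(6)]
  by (simp add: blue_def locally_correct_def coords_correct_iff flag_true_def)

lemma Config_states: "C \<in> Config n m \<Longrightarrow> C p \<in> states n m"
  unfolding Config_def by blast

lemma states_label: "s \<in> states n m \<Longrightarrow> s \<noteq> quiescent \<Longrightarrow> \<exists>l. label s = Some l"
  unfolding states_def by auto

text \<open>The rule only ever overwrites labels, so the other components can be read off the image;
  quiescence is fixed by the position.\<close>

lemma same_image_same_up_to_label:
  assumes "C \<in> Config n m" "C' \<in> Config n m"
    and "ca_map (formula_automaton n m \<phi>) C = ca_map (formula_automaton n m \<phi>) C'"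
  shows "same_up_to_label (C p) (C' p)"
proof -
  have idem: "set_label 0 (set_label l s) = set_label 0 s" for l s
    by (cases s) simp
  have "set_label 0 (ca_map (formula_automaton n m \<phi>) D p) = set_label 0 (D p)" for D
    by (simp add: ca_map_formula_automaton idem)
  from this[of C] this[of C'] have "set_label 0 (C p) = set_label 0 (C' p)"
    by (simp add: assms(3))
  moreover have "D p = quiescent \<longleftrightarrow> p \<notin> grid n m" if "D \<in> Config n m" for D
    using that unfolding Config_def by blast
  ultimately show ?thesis
    using assms(1,2) unfolding same_up_to_label_def by blast
qed

text \<open>A red cell keeps its state, and the two configurations agree on colours, so a difference
  can only sit at a blue cell. There equal images mean equal sums of own and successor label; if the
  own labels differ, so do those of the successors.\<close>

lemma difference_spreads:
  assumes "odd n" "m \<ge> 1" "C \<in> Config n m" "C' \<in> Config n m"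
    and eq: "ca_map (formula_automaton n m \<phi>) C = ca_map (formula_automaton n m \<phi>) C'"
    and ne: "C p \<noteq> C' p"
  shows "blue_at n m \<phi> C p"
    and "coord (C p) = pos x \<Longrightarrow> coord (C (p + (suc n m x - x))) = pos (suc n m x) \<and>
      C (p + (suc n m x - x)) \<noteq> C' (p + (suc n m x - x))"
proof -
  note same = same_image_same_up_to_label[OF assms(3,4) eq]
  have same_blue: "blue_at n m \<phi> C p \<longleftrightarrow> blue_at n m \<phi> C' p"
    unfolding blue_at_def by (intro blue_same_up_to_label same)
  have eq_p: "ca_map (formula_automaton n m \<phi>) C p = ca_map (formula_automaton n m \<phi>) C' p"
    by (simp add: eq)
  show blue: "blue_at n m \<phi> C p"
    using eq_p ne same_blue by (auto simp: ca_map_formula_automaton)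
  assume x: "coord (C p) = pos x"
  then have x': "coord (C' p) = pos x"
    using same_up_to_labelD(1)[OF same] by metis
  let ?q = "p + (suc n m x - x)"
  note S = successor_at_blue[where C = C and p = p, OF assms(1,2) Config_states[OF assms(3)] blue x]
  note S' = successor_at_blue[where C = C' and p = p, OF assms(1,2) Config_states[OF assms(4)]
      blue[unfolded same_blue] x']
  have "the (label (C p)) + the (label (C ?q)) = the (label (C' p)) + the (label (C' ?q))"
    using arg_cong[OF eq_p, of label] blue same_blue S(2) S'(2)
    by (simp add: ca_map_formula_automaton)
  moreover have "C p \<noteq> quiescent" "C' p \<noteq> quiescent"
    using x x' by (auto simp: quiescent_def)
  \<comment> \<open>Labels of non-quiescent states are present, so \<open>the\<close> loses no
    information here.\<close>
  then have "the (label (C p)) \<noteq> the (label (C' p))"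
    using same_up_to_label_label_eqD[OF same] ne states_label[OF Config_states[OF assms(3)]]
      states_label[OF Config_states[OF assms(4)]] by (metis option.sel)
  ultimately have "C ?q \<noteq> C' ?q" by (metis add_right_cancel)
  with S(1) show "coord (C ?q) = pos (suc n m x) \<and> C ?q \<noteq> C' ?q" by blast
qed

text \<open>Positions and written coordinates may differ, but their difference \<open>p0\<close> is constant along
  the cycle; that it is \<open>0\<close> does not matter.\<close>

lemma blue_grid:
  assumes "odd n" "m \<ge> 1" "C \<in> Config n m" "C' \<in> Config n m"
    and eq: "ca_map (formula_automaton n m \<phi>) C = ca_map (formula_automaton n m \<phi>) C'"
    and ne: "C \<noteq> C'"
  obtains p0 where "\<And>y. y \<in> grid n m \<Longrightarrow> coord (C (p0 + y)) = pos y \<and> blue_at n m \<phi> C (p0 + y)"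
proof -
  note spread = difference_spreads[OF assms(1-4) eq]
  obtain p where p: "C p \<noteq> C' p" using ne by blast
  obtain x where x: "coord (C p) = pos x" "x \<in> grid n m"
    using blue_at_coord[OF spread(1)[OF p] Config_states[OF assms(3)]] by blast
  define p0 where "p0 = p - x"
  have "coord (C (p0 + y)) = pos y \<and> C (p0 + y) \<noteq> C' (p0 + y)" if "y \<in> grid n m" for y
  \<comment> \<open>Coordinates and difference are carried along together: the coordinates tell in
    which direction the difference spreads.\<close>
  proof (rule suc_closed_imp_grid[OF assms(1) x(2) _ _ that])
    show "coord (C (p0 + x)) = pos x \<and> C (p0 + x) \<noteq> C' (p0 + x)"
      using x p by (simp add: p0_def)
    show "coord (C (p0 + suc n m z)) = pos (suc n m z) \<and>
        C (p0 + suc n m z) \<noteq> C' (p0 + suc n m z)"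
      if "coord (C (p0 + z)) = pos z \<and> C (p0 + z) \<noteq> C' (p0 + z)" for z
      using spread(2)[of "p0 + z" z] that by (simp add: add.assoc)
  qed
  with spread(1) that show thesis by blast
qed


section \<open>Blue grids and satisfying assignments\<close>

text \<open>Known coordinates remove the existential quantifier of the definition and already
  exclude \<open>quiescent\<close>.\<close>

lemma locally_correct_iff:
  assumes "coord s1 = pos (i, j)"
  shows "locally_correct n m \<phi> s1 s2 s3 s4 s5 \<longleftrightarrow>
       coords_correct n m (i, j) s2 s3 s4 s5 \<and>
       (1 \<le> i \<and> i \<le> int n \<and> 1 \<le> j \<and> j \<le> int m \<longrightarrow>
          (flag s1 = Some 1 \<longleftrightarrow> Pos (nat j) \<in> clause_at \<phi> i) \<and>
          (flag s1 = Some (-1) \<longleftrightarrow> Neg (nat j) \<in> clause_at \<phi> i) \<and>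
          (flag s1 = Some 0 \<longleftrightarrow>
             Pos (nat j) \<notin> clause_at \<phi> i \<and> Neg (nat j) \<notin> clause_at \<phi> i)) \<and>
       (1 \<le> j \<and> j \<le> int m \<longrightarrow> (\<forall>s\<in>{s4, s5}. s \<noteq> quiescent \<longrightarrow> aval s = aval s1)) \<and>
       (j = int m + 1 \<and> 2 \<le> i \<longrightarrow>
          (pc s1 = Some 1 \<longleftrightarrow> pc s5 = Some 1 \<and> pd s3 = Some 1)) \<and>
       ((i, j) = (1, int m + 1) \<longrightarrow> (pc s1 = Some 1 \<longleftrightarrow> pd s3 = Some 1)) \<and>
       (1 \<le> i \<and> i \<le> int n \<and> 2 \<le> j \<and> j \<le> int m \<longrightarrow>
          (pd s1 = Some 1 \<longleftrightarrow> pd s3 = Some 1 \<or> flag_true s1)) \<and>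
       (1 \<le> i \<and> i \<le> int n \<and> j = 1 \<longrightarrow> (pd s1 = Some 1 \<longleftrightarrow> flag_true s1))"
proof -
  have "s1 \<noteq> quiescent" using assms by (auto simp: quiescent_def)
  then show ?thesis
    using assms unfolding locally_correct_def by auto
qed

text \<open>The blue output cell has \<open>pc = 1\<close>. Reading the evaluation backwards, this
  gives \<open>pc = 1\<close> in all clause rows, then \<open>pd = 1\<close> at the end of each row,
  and finally a true literal in each clause.\<close>

lemma blue_grid_imp_satisfiable:
  assumes "n \<ge> 1" "m \<ge> 1" "length \<phi> = n"
    and blue: "\<And>y. y \<in> grid n m \<Longrightarrow> coord (C (p0 + y)) = pos y \<and> blue_at n m \<phi> C (p0 + y)"
  shows "satisfiable \<phi>"
proof -
  define A where "A i j = C (p0 + (i, j))" for i j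
  have coord_A: "coord (A i j) = pos (i, j)" if "(i, j) \<in> grid n m" for i j
    using blue[OF that] by (simp add: A_def)
  have blue_A: "blue n m \<phi> (A i j) (A i (j + 1)) (A i (j - 1)) (A (i + 1) j) (A (i - 1) j)"
    if "(i, j) \<in> grid n m" for i j
    using blue[OF that] by (simp add: A_def blue_at_def add.assoc)
  have lc: "locally_correct n m \<phi> (A i j) (A i (j + 1)) (A i (j - 1)) (A (i + 1) j) (A (i - 1) j)"
    if "(i, j) \<in> grid n m" for i j
    using blue_A[OF that] by (simp add: blue_def)
  have gridI: "(i, j) \<in> grid n m" if "0 \<le> i" "i \<le> int n" "0 \<le> j" "j \<le> int m + 1" for i j
    using that by (simp add: grid_def)
  \<comment> \<open>Row 0 supplies the assignment; \<open>aval_A\<close> then shows that each column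
    repeats its value.\<close>
  define v where "v k \<longleftrightarrow> aval (A 0 (int k)) = Some 1" for k
  have aval_A: "aval (A i j) = aval (A 0 j)" if "0 \<le> i" "i \<le> int n" "1 \<le> j" "j \<le> int m" for i j
  proof -
    from \<open>0 \<le> i\<close> have "i \<le> int n \<longrightarrow> aval (A i j) = aval (A 0 j)"
    proof (induction i rule: int_ge_induct)
      case (step i)
      show ?case
      proof
        assume i: "i + 1 \<le> int n"
        have "A i j \<noteq> quiescent"
          using coord_A[OF gridI, of i j] step i that by (auto simp: quiescent_def)
        then have "aval (A i j) = aval (A (i + 1) j)"
          using lc[OF gridI, of "i + 1" j] step i that
          by (simp add: locally_correct_iff[OF coord_A[OF gridI]])
        then show "aval (A (i + 1) j) = aval (A 0 j)" using step i by simp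
      qed
    qed simp
    then show ?thesis using that by simp
  qed
  \<comment> \<open>Induction upwards along the last column, starting at the output cell, the only
    cell whose blueness demands \<open>pc = 1\<close> outright.\<close>
  have pc_A: "pc (A i (int m + 1)) = Some 1" if "1 \<le> i" "i \<le> int n" for i
  proof -
    from \<open>i \<le> int n\<close> have "1 \<le> i \<longrightarrow> pc (A i (int m + 1)) = Some 1"
    proof (induction i rule: int_le_induct)
      case base
      show ?case
        using blue_A[OF gridI, of "int n" "int m + 1"] coord_A[OF gridI, of "int n" "int m + 1"]
        by (simp add: blue_def)
    next
      case (step i)
      then show ?case
        using lc[OF gridI, of i "int m + 1"]
        by (auto simp: locally_correct_iff[OF coord_A[OF gridI]])
    qed
    then show ?thesis using that by simp
  qed
  \<comment> \<open>Row 1 has no \<open>pc\<close> value above it, hence the separate case.\<close>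
  have pd_A: "pd (A i (int m)) = Some 1" if "1 \<le> i" "i \<le> int n" for i
    using lc[OF gridI, of i "int m + 1"] pc_A[OF that] that
    by (cases "i = 1") (auto simp: locally_correct_iff[OF coord_A[OF gridI]])
  \<comment> \<open>\<open>pd\<close> is a disjunction accumulated from the left, so a value 1 is
    traced back to some column whose own flag causes it, at the latest column 1.\<close>
  have pd_flag: "\<exists>k. 1 \<le> k \<and> k \<le> int m \<and> flag_true (A i k)"
    if "pd (A i j) = Some 1" "1 \<le> i" "i \<le> int n" "1 \<le> j" "j \<le> int m" for i j
  proof -
    let ?goal = "\<exists>k. 1 \<le> k \<and> k \<le> int m \<and> flag_true (A i k)"
    from \<open>1 \<le> j\<close> have "j \<le> int m \<longrightarrow> pd (A i j) = Some 1 \<longrightarrow> ?goal"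
    proof (induction j rule: int_ge_induct)
      case base
      then show ?case
        using lc[OF gridI, of i 1] that
        by (auto simp: locally_correct_iff[OF coord_A[OF gridI]])
    next
      case (step j)
      show ?case
      proof (intro impI)
        assume j: "j + 1 \<le> int m" "pd (A i (j + 1)) = Some 1"
        then have "pd (A i j) = Some 1 \<or> flag_true (A i (j + 1))"
          using lc[OF gridI, of i "j + 1"] that step
          by (simp add: locally_correct_iff[OF coord_A[OF gridI]])
        then show ?goal
        proof
          assume "flag_true (A i (j + 1))"
          with j step show ?goal by (intro exI[of _ "j + 1"]) simp
        qed (use step j in simp)
      qed
    qed
    then show ?thesis using that by simp
  qed
  have "\<exists>l\<in>K. literal_true v l" if "K \<in> set \<phi>" for K
  proof -
    from that obtain t where t: "t < n" "K = \<phi> ! t"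
      using assms(3) by (metis in_set_conv_nth)
    \<comment> \<open>Clauses are numbered from 1, list entries from 0.\<close>
    define i where "i = int t + 1"
    have i: "1 \<le> i" "i \<le> int n" and K: "clause_at \<phi> i = K"
      using t by (simp_all add: i_def clause_at_def)
    obtain k where k: "1 \<le> k" "k \<le> int m" "flag_true (A i k)"
      using pd_flag[OF pd_A[OF i] i] \<open>m \<ge> 1\<close> by auto
    have "(flag (A i k) = Some 1 \<longleftrightarrow> Pos (nat k) \<in> K) \<and> (flag (A i k) = Some (-1) \<longleftrightarrow> Neg (nat k) \<in> K)"
      using lc[OF gridI, of i k] i k
      by (simp add: locally_correct_iff[OF coord_A[OF gridI]] K)
    moreover have "v (nat k) \<longleftrightarrow> aval (A i k) = Some 1"
      using aval_A[of i k] i k by (simp add: v_def)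
    ultimately show ?thesis
      using k(3) unfolding flag_true_def
      by (metis literal_true.simps option.inject zero_neq_one)
  qed
  then show ?thesis unfolding satisfiable_def by blast
qed

section \<open>The all-blue configuration of a satisfying assignment\<close>

definition clause_flag :: "clause \<Rightarrow> int \<Rightarrow> int" where
  "clause_flag K j = (if Pos (nat j) \<in> K then 1 else if Neg (nat j) \<in> K then -1 else 0)"

text \<open>The correct \<open>pd\<close> value in column \<open>j\<close> of the row of
  \<open>K\<close>; at \<open>j = m\<close> it is the truth value of a clause over the
  \<open>m\<close> variables.\<close>

definition prefix_true :: "(nat \<Rightarrow> bool) \<Rightarrow> clause \<Rightarrow> int \<Rightarrow> bool" where
  "prefix_true v K j \<longleftrightarrow> (\<exists>k. 1 \<le> k \<and> k \<le> j \<and>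
     (Pos (nat k) \<in> K \<and> v (nat k) \<or> Neg (nat k) \<in> K \<and> \<not> v (nat k)))"

text \<open>All \<open>pc\<close> values are 1, as is right for a satisfying \<open>v\<close>. The
  common label \<open>l\<close> stays a parameter so that two labellings can be compared.\<close>

definition evaluation_config ::
    "nat \<Rightarrow> nat \<Rightarrow> cnf \<Rightarrow> (nat \<Rightarrow> bool) \<Rightarrow> bit \<Rightarrow> int \<times> int \<Rightarrow> state" where
  "evaluation_config n m \<phi> v l = (\<lambda>(i, j).
     if (i, j) \<notin> grid n m then quiescent
     else State (pos (i, j))
       (if 1 \<le> i \<and> 1 \<le> j \<and> j \<le> int m then Some (clause_flag (clause_at \<phi> i) j) else None)
       (if 1 \<le> j \<and> j \<le> int m then Some (of_bool (v (nat j))) else None)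
       (if 1 \<le> i \<and> 1 \<le> j \<and> j \<le> int m
        then Some (of_bool (prefix_true v (clause_at \<phi> i) j)) else None)
       (if 1 \<le> i \<and> j = int m + 1 then Some 1 else None)
       (Some l))"

lemma evaluation_config_outside:
  "x \<notin> grid n m \<Longrightarrow> evaluation_config n m \<phi> v l x = quiescent"
  by (cases x) (simp add: evaluation_config_def)

lemma evaluation_config_sel:
  assumes "(i, j) \<in> grid n m"
  shows "coord (evaluation_config n m \<phi> v l (i, j)) = pos (i, j)"
    "flag (evaluation_config n m \<phi> v l (i, j)) =
      (if 1 \<le> i \<and> 1 \<le> j \<and> j \<le> int m then Some (clause_flag (clause_at \<phi> i) j) else None)"
    "aval (evaluation_config n m \<phi> v l (i, j)) =
      (if 1 \<le> j \<and> j \<le> int m then Some (of_bool (v (nat j))) else None)"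
    "pd (evaluation_config n m \<phi> v l (i, j)) =
      (if 1 \<le> i \<and> 1 \<le> j \<and> j \<le> int m
       then Some (of_bool (prefix_true v (clause_at \<phi> i) j)) else None)"
    "pc (evaluation_config n m \<phi> v l (i, j)) = (if 1 \<le> i \<and> j = int m + 1 then Some 1 else None)"
    "label (evaluation_config n m \<phi> v l (i, j)) = Some l"
  by (simp_all add: evaluation_config_def assms)

lemma evaluation_config_in_Config: "evaluation_config n m \<phi> v l \<in> Config n m"
proof -
  have "evaluation_config n m \<phi> v l (i, j) \<in> states n m" if "(i, j) \<in> grid n m" for i j
  proof -
    from that have "0 \<le> i" "i \<le> int n" "0 \<le> j" "j \<le> int m + 1"
      by (simp_all add: grid_def)
    \<comment> \<open>The six disjuncts are the non-quiescent cell types of \<open>states\<close>,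
      in the same order.\<close>
    then have "i = 0 \<and> j = 0 \<or> 1 \<le> i \<and> j = 0 \<or> i = 0 \<and> 1 \<le> j \<and> j \<le> int m \<or>
        i = 0 \<and> j = int m + 1 \<or> 1 \<le> i \<and> j = int m + 1 \<or> 1 \<le> i \<and> 1 \<le> j \<and> j \<le> int m"
      by presburger
    moreover have "clause_flag K j \<in> {-1, 0, 1}" for K
      by (simp add: clause_flag_def)
    ultimately show ?thesis
      using that \<open>i \<le> int n\<close> unfolding states_def
      by (elim disjE) (simp_all add: evaluation_config_def)
  qed
  moreover have "quiescent \<in> states n m" by (simp add: states_def)
  moreover have "evaluation_config n m \<phi> v l (i, j) \<noteq> quiescent" if "(i, j) \<in> grid n m" for i j
    using evaluation_config_sel(6)[OF that, of \<phi> v l] by (metis option.distinct(1) quiescent_def state.sel(6))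
  ultimately show ?thesis
    unfolding Config_def using evaluation_config_outside by (auto split: prod.split) metis
qed

text \<open>The recurrence behind both \<open>pd\<close> conditions: for \<open>j = 1\<close> the
  guard \<open>2 \<le> j\<close> leaves only the literal of that column.\<close>

lemma prefix_true_step:
  assumes "1 \<le> j"
  shows "prefix_true v K j \<longleftrightarrow> (2 \<le> j \<and> prefix_true v K (j - 1)) \<or>
    (Pos (nat j) \<in> K \<and> v (nat j) \<or> Neg (nat j) \<in> K \<and> \<not> v (nat j))"
proof -
  have "k \<le> j \<longleftrightarrow> (2 \<le> j \<and> k \<le> j - 1) \<or> k = j" if "1 \<le> k" for k
    using assms that by auto
  then show ?thesis
    using assms unfolding prefix_true_def by blast
qed

text \<open>Satisfaction enters through \<open>full\<close>: each clause row ends with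
  \<open>pd = 1\<close>, which makes the constant \<open>pc = 1\<close> locally correct. The other
  components are correct values by construction.\<close>

lemma evaluation_config_blue:
  assumes "n \<ge> 1" and "m \<ge> 1" and "cnf_formula n m \<phi>"
    and "\<forall>K\<in>set \<phi>. \<forall>j. \<not> (Pos j \<in> K \<and> Neg j \<in> K)"
    and v: "\<forall>K\<in>set \<phi>. \<exists>l\<in>K. literal_true v l"
    and x: "x \<in> grid n m"
  shows "blue_at n m \<phi> (evaluation_config n m \<phi> v l) x"
proof -
  let ?C = "evaluation_config n m \<phi> v l"
  obtain i j where ij: "x = (i, j)" by (cases x)
  have coord_C: "if y \<in> grid n m then coord (?C y) = pos y else ?C y = quiescent" for y
    by (cases y) (simp add: evaluation_config_sel evaluation_config_outside)
  have bounds: "0 \<le> i" "i \<le> int n" "0 \<le> j" "j \<le> int m + 1"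
    using x ij by (auto simp: grid_def)
  have clause: "clause_at \<phi> i \<in> set \<phi>" if "1 \<le> i"
    using that bounds assms(3) by (simp add: clause_at_def cnf_formula_def)
  \<comment> \<open>\<open>clause_flag\<close> prefers the positive literal, so the flag condition
    for a negative one relies on the clause not containing both.\<close>
  have not_both: "\<not> (Pos k \<in> clause_at \<phi> i \<and> Neg k \<in> clause_at \<phi> i)" if "1 \<le> i" for k
    using clause[OF that] assms(4) by blast
  have full: "prefix_true v (clause_at \<phi> i) (int m)" if "1 \<le> i"
  proof -
    note clause_i = clause[OF that]
    obtain t where t: "t \<in> clause_at \<phi> i" "literal_true v t"
      using v clause_i by blast
    moreover obtain k where "k \<in> {1..m}" "t = Pos k \<or> t = Neg k"
      using assms(3) clause_i t unfolding cnf_formula_def by blast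
    ultimately show ?thesis
      unfolding prefix_true_def by (intro exI[of _ "int k"]) auto
  qed
  have coordx: "coord (?C (i, j)) = pos (i, j)"
    using coord_C[of "(i, j)"] x ij by simp
  then have not_quiescent: "?C (i, j) \<noteq> quiescent"
    by (auto simp: quiescent_def)
  \<comment> \<open>The value depends on the column only, so it agrees with that of any neighbour
    above or below inside the grid.\<close>
  have aval_C: "aval (?C (k, j)) = Some (of_bool (v (nat j)))"
    if "?C (k, j) \<noteq> quiescent" "1 \<le> j" "j \<le> int m" for k
    using that evaluation_config_sel(3)[of k j] evaluation_config_outside[of "(k, j)"] by metis
  have flag_true_C: "flag_true (?C (i, j)) \<longleftrightarrow>
      Pos (nat j) \<in> clause_at \<phi> i \<and> v (nat j) \<or> Neg (nat j) \<in> clause_at \<phi> i \<and> \<not> v (nat j)"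
    if "1 \<le> i" "1 \<le> j" "j \<le> int m"
    using that x ij not_both[of "nat j"]
    by (simp add: flag_true_def evaluation_config_sel clause_flag_def)
  have pd_C: "pd (?C (i, k)) = Some 1 \<longleftrightarrow> prefix_true v (clause_at \<phi> i) k"
    if "1 \<le> i" "1 \<le> k" "k \<le> int m" for k
    using that bounds evaluation_config_sel(4)[of i k n m \<phi> v l] by (simp add: grid_def)
  have pc_C: "pc (?C (k, int m + 1)) = Some 1" if "1 \<le> k" "k \<le> int n" for k
    using that evaluation_config_sel(5)[of k "int m + 1" n m \<phi> v l] by (simp add: grid_def)
  have flag_C: "flag (?C (i, j)) = Some (clause_flag (clause_at \<phi> i) j)"
    if "1 \<le> i" "1 \<le> j" "j \<le> int m"
    using that x ij by (simp add: evaluation_config_sel)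
  have "locally_correct n m \<phi> (?C (i, j)) (?C (i, j + 1)) (?C (i, j - 1)) (?C (i + 1, j)) (?C (i - 1, j))"
    unfolding locally_correct_iff[OF coordx]
  proof (intro conjI impI)
    show "coords_correct n m (i, j) (?C (i, j + 1)) (?C (i, j - 1)) (?C (i + 1, j)) (?C (i - 1, j))"
      using coord_C[of "(i, j + 1)"] coord_C[of "(i, j - 1)"] coord_C[of "(i + 1, j)"]
        coord_C[of "(i - 1, j)"]
      by (simp add: coords_correct_iff)
  next
    assume "1 \<le> j \<and> j \<le> int m"
    then show "\<forall>s\<in>{?C (i + 1, j), ?C (i - 1, j)}. s \<noteq> quiescent \<longrightarrow> aval s = aval (?C (i, j))"
      using aval_C not_quiescent by simp
  next
    assume "1 \<le> i \<and> i \<le> int n \<and> 2 \<le> j \<and> j \<le> int m"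
    then show "pd (?C (i, j)) = Some 1 \<longleftrightarrow> pd (?C (i, j - 1)) = Some 1 \<or> flag_true (?C (i, j))"
      using pd_C flag_true_C prefix_true_step[of j] by simp
  next
    assume "1 \<le> i \<and> i \<le> int n \<and> j = 1"
    then show "pd (?C (i, j)) = Some 1 \<longleftrightarrow> flag_true (?C (i, j))"
      using pd_C flag_true_C prefix_true_step[of j] \<open>m \<ge> 1\<close> by simp
  \<comment> \<open>What remains are the flag and the \<open>pc\<close> conditions; the latter
    reduce to \<open>full\<close>.\<close>
  qed (use flag_C not_both pc_C pd_C full \<open>m \<ge> 1\<close> bounds in \<open>auto simp: clause_flag_def\<close>)
  moreover have "coord (?C (i, j)) = pos (int n, int m + 1) \<longrightarrow> pc (?C (i, j)) = Some 1"
    using coordx pc_C[of i] \<open>n \<ge> 1\<close> by auto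
  ultimately show ?thesis
    by (simp add: blue_at_def blue_def ij)
qed

theorem theorem4p16:
  fixes n m :: nat and \<phi> :: cnf
  assumes "n \<ge> 1" and "m \<ge> 1" and "odd n"
    and "cnf_formula n m \<phi>"
    and "\<forall>C\<in>set \<phi>. \<forall>j. \<not> (Pos j \<in> C \<and> Neg j \<in> C)"
  shows "inj_on (ca_map (formula_automaton n m \<phi>)) (Config n m) \<longleftrightarrow> \<not> satisfiable \<phi>"
proof
  assume inj: "inj_on (ca_map (formula_automaton n m \<phi>)) (Config n m)"
  show "\<not> satisfiable \<phi>"
  proof
    assume "satisfiable \<phi>"
    then obtain v where v: "\<forall>K\<in>set \<phi>. \<exists>l\<in>K. literal_true v l"
      unfolding satisfiable_def by blast
    let ?C = "evaluation_config n m \<phi> v"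
    note Config = evaluation_config_in_Config
    have label_C: "label (?C l x) = Some l" if "x \<in> grid n m" for l x
      using that by (cases x) (simp add: evaluation_config_sel)
    \<comment> \<open>The image does not depend on \<open>l\<close>: every label in the grid becomes
      \<open>l + l = 0\<close>.\<close>
    have "ca_map (formula_automaton n m \<phi>) (?C l) x = ?C 0 x" for l x
    proof (cases "x \<in> grid n m")
      case True
      note blue = evaluation_config_blue[OF assms(1,2,4,5) v True, of l]
      obtain y where y: "coord (?C l x) = pos y" "y \<in> grid n m"
        using blue_at_coord[OF blue Config_states[OF Config]] by blast
      note S = successor_at_blue[OF assms(3,2) Config_states[OF Config] blue y(1)]
      \<comment> \<open>The successor's state has coordinates, so its position lies in the grid and
        its label is \<open>l\<close> as well.\<close>
      have "?C l (x + (suc n m y - y)) \<noteq> quiescent"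
        using S(1) by (auto simp: quiescent_def)
      then have "x + (suc n m y - y) \<in> grid n m"
        using Config[of n m \<phi> v l] unfolding Config_def by blast
      then have "label (successor_at n m (?C l) x) = Some l"
        using label_C S(2) by simp
      moreover have "set_label 0 (?C l x) = ?C 0 x"
        using True by (cases x) (simp add: evaluation_config_def)
      ultimately show ?thesis
        using blue label_C[OF True] by (simp add: ca_map_formula_automaton)
    next
      case False
      then have q: "?C k x = quiescent" for k
        by (rule evaluation_config_outside)
      then have "\<not> blue_at n m \<phi> (?C l) x"
        by (simp add: blue_at_def blue_def locally_correct_def)
      with q show ?thesis by (simp add: ca_map_formula_automaton)
    qed
    then have "ca_map (formula_automaton n m \<phi>) (?C 0) = ca_map (formula_automaton n m \<phi>) (?C 1)"
      by (simp add: fun_eq_iff)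
    with inj Config have "?C 0 = ?C 1"
      by (meson inj_onD)
    \<comment> \<open>The two configurations differ in label at every grid cell; the origin serves
      as a concrete one.\<close>
    moreover have "(0, 0) \<in> grid n m" by (simp add: grid_def)
    ultimately show False
      using label_C[of "(0, 0)"] by (metis option.inject zero_neq_one)
  qed
next
  assume unsat: "\<not> satisfiable \<phi>"
  show "inj_on (ca_map (formula_automaton n m \<phi>)) (Config n m)"
  proof (rule inj_onI, rule ccontr)
    fix C C'
    assume *: "C \<in> Config n m" "C' \<in> Config n m"
      "ca_map (formula_automaton n m \<phi>) C = ca_map (formula_automaton n m \<phi>) C'" "C \<noteq> C'"
    obtain p0 where p0: "\<And>y. y \<in> grid n m \<Longrightarrow>
        coord (C (p0 + y)) = pos y \<and> blue_at n m \<phi> C (p0 + y)"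
      using blue_grid[OF assms(3,2) *] by blast
    have "length \<phi> = n"
      using assms(4) by (simp add: cnf_formula_def)
    from blue_grid_imp_satisfiable[OF assms(1,2) this p0] unsat show False by blast
  qed
qed

end
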